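(* Let $(X,\tau)$ be a p-closed $T_0$ space. Then $(X,\tau)$ is strongly irresolvable.
   Context: A subset $A$ of a space $(X,\tau)$ is preopen if $A \subseteq \mathrm{int}(\mathrm{cl}(A))$; it is preclosed if its complement is preopen, i.e. $\mathrm{cl}(\mathrm{int}(A)) \subseteq A$. The preclosure $\mathrm{pcl}(A)$ is the intersection of all preclosed supersets of $A$ (it is itself preclosed). $(X,\tau)$ is p-closed if for every cover $\{V_\alpha : \alpha\in A\}$ of $X$ by preopen sets there is a finite $A_0\subseteq A$ with $X=\bigcup_{\alpha\in A_0}\mathrm{pcl}(V_\alpha)$. A space is resolvable if it is the disjoint union of two dense subsets, and irresolvable otherwise; $(X,\tau)$ is strongly irresolvable if every nonempty open subspace of $X$ is irresolvable. *)

theory Defs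
  imports "HOL-Analysis.Analysis"
begin

definition preopen_in :: "'a topology \<Rightarrow> 'a set \<Rightarrow> bool" where
  "preopen_in X A \<longleftrightarrow> A \<subseteq> topspace X \<and> A \<subseteq> X interior_of (X closure_of A)"

definition preclosed_in :: "'a topology \<Rightarrow> 'a set \<Rightarrow> bool" where
  "preclosed_in X A \<longleftrightarrow> A \<subseteq> topspace X \<and> preopen_in X (topspace X - A)"

(* Only meaningful for A \<subseteq> topspace X; otherwise the intersected family is empty. *)
definition preclosure_of :: "'a topology \<Rightarrow> 'a set \<Rightarrow> 'a set" (infixr \<open>preclosure'_of\<close> 80) where
  "X preclosure_of A = \<Inter>{C. preclosed_in X C \<and> A \<subseteq> C}"

definition p_closed_space :: "'a topology \<Rightarrow> bool" where
  "p_closed_space X \<longleftrightarrow>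
     (\<forall>\<V>. (\<forall>V\<in>\<V>. preopen_in X V) \<and> \<Union>\<V> = topspace X \<longrightarrow>
        (\<exists>\<F>. finite \<F> \<and> \<F> \<subseteq> \<V> \<and> topspace X = (\<Union>V\<in>\<F>. X preclosure_of V)))"

definition dense_subset_of :: "'a topology \<Rightarrow> 'a set \<Rightarrow> bool" where
  "dense_subset_of X D \<longleftrightarrow> D \<subseteq> topspace X \<and> X closure_of D = topspace X"

definition resolvable_space :: "'a topology \<Rightarrow> bool" where
  "resolvable_space X \<longleftrightarrow>
     (\<exists>D E. dense_subset_of X D \<and> dense_subset_of X E \<and> D \<inter> E = {} \<and> D \<union> E = topspace X)"

definition strongly_irresolvable_space :: "'a topology \<Rightarrow> bool" where
  "strongly_irresolvable_space X \<longleftrightarrow>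
     (\<forall>U. openin X U \<and> U \<noteq> {} \<longrightarrow> \<not> resolvable_space (subtopology X U))"

end

theory Submission
  imports Defs
begin

text \<open>
  Suppose that some nonempty open \<open>U\<close> is the disjoint union of two sets \<open>D\<close> and \<open>E\<close>, both dense in
  it. A set lying densely in an open set is preopen, a subset of the space with empty interior is
  preclosed, and a preclosed set equals its preclosure. The complement of \<open>E\<close> and the sets
  \<open>insert x D\<close> with \<open>x \<in> E\<close> are preopen and cover the space; the complement of \<open>E\<close> is also
  preclosed, because \<open>E\<close> is preopen. If every \<open>insert x D\<close> has empty interior, then all members of
  this cover are their own preclosures, and as each \<open>x \<in> E\<close> lies in \<open>insert x D\<close> only, the cover
  contradicts p-closedness as soon as \<open>E\<close> is infinite (\<open>not_p_closed_space_if_dense_pair\<close>).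

  This applies at once if every nonempty open subset of \<open>U\<close> meets \<open>E\<close> in an infinite set, since the
  interior of \<open>insert x D\<close> meets \<open>E\<close> in at most one point. Otherwise the \<open>T\<^sub>0\<close> axiom
  allows an open set with finite trace on \<open>E\<close> to be shrunk to an open \<open>G\<close> whose trace is a single
  point \<open>x\<close> (\<open>t0_space_open_singleton_trace\<close>). Then \<open>{x}\<close> is dense in \<open>G\<close>, and so is
  \<open>G - {x} \<subseteq> D\<close>; the same argument now applies to this pair inside \<open>G\<close>. Its hypotheses hold because
  nonempty open subsets of \<open>U\<close> are infinite: a finite one would, again by \<open>T\<^sub>0\<close>, contain an
  open singleton, which cannot meet both \<open>D\<close> and \<open>E\<close>.
\<close>

lemma meets_dense:
  assumes "openin X W" "W \<noteq> {}" "W \<subseteq> X closure_of D"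
  shows "W \<inter> D \<noteq> {}"
  using assms by (metis inf.orderE openin_Int_closure_of_eq_empty)

lemma preopen_in_if_dense_in_open:
  assumes "openin X U" "A \<subseteq> U" "U \<subseteq> X closure_of A"
  shows "preopen_in X A"
  using assms unfolding preopen_in_def
  by (meson interior_of_maximal openin_subset order_trans)

lemma preclosed_in_if_empty_interior:
  assumes "A \<subseteq> topspace X" "X interior_of A = {}"
  shows "preclosed_in X A"
  using assms by (simp add: preclosed_in_def preopen_in_def closure_of_complement)

lemma preclosure_of_preclosed_in:
  assumes "preclosed_in X A"
  shows "X preclosure_of A = A"
  using assms unfolding preclosure_of_def by blast

text \<open>Two points of a finite trace are separated by an open set containing exactly one of them, and
  intersecting with that set gives a smaller trace that is still nonempty.\<close>
lemma t0_space_open_singleton_trace: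
  assumes "t0_space X" "openin X G" "G \<noteq> {}" "finite (G \<inter> E)" "G \<subseteq> X closure_of E"
  obtains W x where "openin X W" "W \<subseteq> G" "W \<inter> E = {x}"
proof -
  have "\<exists>W x. openin X W \<and> W \<subseteq> G \<and> W \<inter> E = {x}"
    using assms(2-)
  proof (induction "card (G \<inter> E)" arbitrary: G rule: less_induct)
    case less
    obtain a where a: "a \<in> G" "a \<in> E"
      using meets_dense less.prems by blast
    show ?case
    proof (cases "G \<inter> E = {a}")
      case True
      then show ?thesis using less.prems(1) by blast
    next
      case False
      then obtain b where b: "b \<in> G" "b \<in> E" "b \<noteq> a"
        using a by blast
      have "a \<in> topspace X" "b \<in> topspace X"
        using a b less.prems(1) openin_subset by blast+
      then obtain V where V: "openin X V" "(a \<in> V) \<noteq> (b \<in> V)"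
        using \<open>t0_space X\<close> b(3) unfolding t0_space_def by metis
      have smaller: "(G \<inter> V) \<inter> E \<subset> G \<inter> E"
        using a b V by blast
      then have "card ((G \<inter> V) \<inter> E) < card (G \<inter> E)"
        using less.prems(3) by (rule psubset_card_mono[rotated])
      moreover have "openin X (G \<inter> V)" "G \<inter> V \<noteq> {}" "G \<inter> V \<subseteq> X closure_of E"
        using a b V less.prems by auto
      moreover have "finite ((G \<inter> V) \<inter> E)"
        using smaller less.prems(3) finite_subset by blast
      ultimately obtain W x where "openin X W" "W \<subseteq> G \<inter> V" "W \<inter> E = {x}"
        using less.hyps by meson
      then show ?thesis by blast
    qed
  qed
  then show ?thesis using that by blast
qed

text \<open>The witnessing cover consists of the complement of \<open>E\<close> and the sets \<open>insert x D\<close>. All of them are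
  both preopen and preclosed, so that taking preclosures gains nothing, and a finite subfamily
  covers only finitely many points of \<open>E\<close>.\<close>
lemma not_p_closed_space_if_dense_pair:
  assumes U: "openin X U"
    and D: "D \<subseteq> U" "U \<subseteq> X closure_of D"
    and E: "E \<subseteq> U" "U \<subseteq> X closure_of E"
    and disj: "D \<inter> E = {}"
    and inf: "infinite E"
    and int: "\<And>x. x \<in> E \<Longrightarrow> X interior_of (insert x D) = {}"
  shows "\<not> p_closed_space X"
proof
  assume pc: "p_closed_space X"
  have UX: "U \<subseteq> topspace X"
    using U by (rule openin_subset)
  \<comment> \<open>The complement of \<open>E\<close> is preclosed because \<open>E\<close> is preopen, and preopen because \<open>D\<close>
    leaves \<open>E\<close> no interior.\<close>
  have "preopen_in X E"
    using preopen_in_if_dense_in_open U E by blast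
  then have rest_closed: "preclosed_in X (topspace X - E)"
    using E UX by (simp add: preclosed_in_def double_diff)
  have "X interior_of E \<inter> D = {}"
    using disj interior_of_subset[of X E] by blast
  moreover have "X interior_of E \<subseteq> X closure_of D"
    using interior_of_subset[of X E] E(1) D(2) by blast
  ultimately have "X interior_of E = {}"
    using meets_dense[OF openin_interior_of] by blast
  then have rest_open: "preopen_in X (topspace X - E)"
    by (simp add: preopen_in_def closure_of_complement)
  have point_open: "preopen_in X (insert x D)" if "x \<in> E" for x
  proof (rule preopen_in_if_dense_in_open[OF U])
    show "insert x D \<subseteq> U" using that D E by blast
    show "U \<subseteq> X closure_of (insert x D)"
      using D(2) closure_of_mono[of D "insert x D" X] by blast
  qed
  have point_closed: "preclosed_in X (insert x D)" if "x \<in> E" for x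
    using that D E UX int by (intro preclosed_in_if_empty_interior) auto
  let ?\<V> = "insert (topspace X - E) ((\<lambda>x. insert x D) ` E)"
  have "E \<noteq> {}"
    using inf by auto
  then have "\<Union>?\<V> = topspace X"
    using D E UX by auto
  moreover have "\<forall>V\<in>?\<V>. preopen_in X V"
    using rest_open point_open by blast
  ultimately obtain \<F> where \<F>: "finite \<F>" "\<F> \<subseteq> ?\<V>"
      "topspace X = (\<Union>V\<in>\<F>. X preclosure_of V)"
    using pc unfolding p_closed_space_def by meson
  have "\<forall>V\<in>\<F>. X preclosure_of V = V"
    using \<F>(2) rest_closed point_closed preclosure_of_preclosed_in by blast
  then have cover: "topspace X = \<Union>\<F>"
    using \<F>(3) by simp
  have "finite (\<F> - {topspace X - E})" "\<F> - {topspace X - E} \<subseteq> (\<lambda>x. insert x D) ` E"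
    using \<F> by auto
  then obtain E0 where E0: "finite E0" "\<F> - {topspace X - E} = (\<lambda>x. insert x D) ` E0"
    by (meson finite_subset_image)
  have "E \<subseteq> E0"
  proof
    fix x assume "x \<in> E"
    then obtain V where "V \<in> \<F>" "x \<in> V"
      using cover E UX by blast
    then have "V \<in> (\<lambda>x. insert x D) ` E0"
      using \<open>x \<in> E\<close> E0(2) by blast
    then show "x \<in> E0"
      using \<open>x \<in> V\<close> \<open>x \<in> E\<close> disj by blast
  qed
  then show False
    using inf E0(1) finite_subset by blast
qed

theorem theorem2p3:
  fixes X :: "'a topology"
  assumes "p_closed_space X" and "t0_space X"
  shows "strongly_irresolvable_space X"
  unfolding strongly_irresolvable_space_def
proof (intro allI impI notI, elim conjE)
  fix U
  assume U: "openin X U" "U \<noteq> {}" and "resolvable_space (subtopology X U)"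
  have UX: "U \<subseteq> topspace X"
    using U(1) by (rule openin_subset)
  from \<open>resolvable_space (subtopology X U)\<close>
  obtain D E where DE: "D \<inter> E = {}" "D \<union> E = U"
      and "subtopology X U closure_of D = U" "subtopology X U closure_of E = U"
    unfolding resolvable_space_def dense_subset_of_def topspace_subtopology_subset[OF UX]
    by (elim exE conjE)
  then have cl: "U \<subseteq> X closure_of D" "U \<subseteq> X closure_of E"
    by (auto simp: closure_of_subtopology)
  \<comment> \<open>A finite trace on the whole space is shrunk to an open singleton, too small for both \<open>D\<close>
    and \<open>E\<close>.\<close>
  have open_infinite: "infinite W" if W: "openin X W" "W \<noteq> {}" "W \<subseteq> U" for W
  proof
    assume "finite W"
    moreover have "W \<subseteq> X closure_of UNIV"
      using W(1) closure_of_topspace[of X] closure_of_restrict[of X UNIV] openin_subset by auto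
    ultimately obtain V z where V: "openin X V" "V \<subseteq> W" "V \<inter> UNIV = {z}"
      using t0_space_open_singleton_trace[OF assms(2) W(1,2), of UNIV] by auto
    have "V \<noteq> {}" "V \<subseteq> X closure_of D" "V \<subseteq> X closure_of E"
      using V(2,3) W(3) cl by auto
    then have "V \<inter> D \<noteq> {}" "V \<inter> E \<noteq> {}"
      using meets_dense[OF V(1)] by simp_all
    then show False
      using V(3) DE(1) by auto
  qed
  show False
  proof (cases "\<exists>G. openin X G \<and> G \<noteq> {} \<and> G \<subseteq> U \<and> finite (G \<inter> E)")
    case False
    have "X interior_of (insert x D) = {}" if "x \<in> E" for x
    proof (rule ccontr)
      assume "X interior_of (insert x D) \<noteq> {}"
      moreover have "X interior_of (insert x D) \<subseteq> insert x D"
        by (rule interior_of_subset)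
      moreover from this have "X interior_of (insert x D) \<subseteq> U"
        using that DE(2) by blast
      ultimately have "infinite (X interior_of (insert x D) \<inter> E)"
        using False openin_interior_of by blast
      moreover have "X interior_of (insert x D) \<inter> E \<subseteq> {x}"
        using \<open>X interior_of (insert x D) \<subseteq> insert x D\<close> DE(1) by blast
      ultimately show False
        using finite_subset by blast
    qed
    moreover have "infinite E"
      using False U DE(2) by (metis finite_Int order_refl)
    ultimately show False
      using not_p_closed_space_if_dense_pair[OF U(1) _ cl(1) _ cl(2) DE(1)] DE(2) assms(1)
      by auto
  next
    case True
    then obtain G0 where G0: "openin X G0" "G0 \<noteq> {}" "G0 \<subseteq> U" "finite (G0 \<inter> E)"
      by blast
    have "G0 \<subseteq> X closure_of E"
      using G0(3) cl(2) by (rule order_trans)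
    then obtain G x where G: "openin X G" "G \<subseteq> G0" "G \<inter> E = {x}"
      using t0_space_open_singleton_trace[OF assms(2) G0(1,2,4)] by auto
    have xG: "x \<in> G" and GU: "G \<subseteq> U"
      using G G0 by auto
    have "G \<subseteq> X closure_of (G \<inter> E)" "G \<subseteq> X closure_of (G \<inter> D)"
      using openin_Int_closure_of_subset[OF G(1)] GU cl by (metis inf.absorb1 order_trans)+
    moreover have "G \<inter> D = G - {x}"
      using G(3) DE GU by blast
    \<comment> \<open>From here on \<open>{x}\<close> and \<open>G - {x}\<close> take the roles of \<open>D\<close> and \<open>E\<close>.\<close>
    ultimately have dense: "G \<subseteq> X closure_of {x}" "G \<subseteq> X closure_of (G - {x})"
      using G(3) by auto
    have "infinite (G - {x})"
      using open_infinite[of G] G(1) GU xG by auto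
    moreover have "X interior_of {y, x} = {}" if "y \<in> G - {x}" for y
    proof (rule ccontr)
      assume "X interior_of {y, x} \<noteq> {}"
      moreover have sub: "X interior_of {y, x} \<subseteq> {y, x}"
        by (rule interior_of_subset)
      ultimately have "infinite (X interior_of {y, x})"
        using that xG GU by (intro open_infinite) auto
      then show False
        using sub finite_subset by blast
    qed
    ultimately show False
      using not_p_closed_space_if_dense_pair[OF G(1) _ dense(1) _ dense(2)] xG assms(1)
      by auto
  qed
qed

end
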